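(* Let $\hat{\mathcal G}$ be the augmented graph of convex sets of a key-door environment with $n$ keys and $n$ doors. Every path in $\hat{\mathcal G}$ from the start node $s$ to the merged target node $t$ corresponds to a trajectory that satisfies the key-door precedence specification $\varphi=\bigwedge_{i=1}^{n}(K_i\,\mathcal R\,\neg D_i)\wedge\mathcal F(\mathcal T)$.
   Context: Environment. $\mathcal X\subset\mathbb R^d$ is a bounded polytope containing polytopic obstacles $O_1,\dots,O_{n_O}$, polytopic key regions $K_1,\dots,K_n$ and polytopic door regions $D_1,\dots,D_n$; key $K_i$ unlocks door $D_i$. Trajectories $q$ on $[0,T]$ go from $q(0)=q_0$ to $q(T)=q_T$ and are parameterized by piecewise Bézier curves. Temporal logic. $K_i$, $D_i$, $\mathcal T$ denote the propositions that the trajectory is in the region $K_i$, $D_i$, or in the target set $\mathcal T$ (containing $q_T$). $\phi\,\mathcal R\,\psi$: $\psi$ holds until and including when $\phi$ becomes true, and always if $\phi$ never becomes true. $\mathcal F\phi$: $\phi$ eventually holds. Labeled graph $\mathcal G(\mathcal V,\mathcal E)$, $\mathcal V=\mathcal V_{\mathcal C}\cup\mathcal V_{\mathcal K}\cup\mathcal V_{\mathcal D}$. The hyperplanes bounding $\mathcal X$, the obstacles and the doors cut $\mathcal X$ into convex cells; cells in obstacles are discarded, the cells in a door $D_i$ are merged into one door vertex, and the remaining cells (possibly further merged as long as convexity is preserved) are the free-space vertices $\mathcal V_{\mathcal C}$. Cells sharing a facet are joined by an edge. Each key region gives a key vertex, joined to every free-space vertex whose set intersects it. A start node $s$ is connected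 to a free-space vertex whose set contains $q_0$; the target node $t\in\mathcal V_{\mathcal C}$ has a set containing $q_T$. Paths and trajectories. Each vertex $v$ carries a variable $x_v$ consisting of the Bézier control points (and time scaling) of a trajectory segment lying in the convex region of $v$; edges carry convex constraints imposing continuity between consecutive segments (and velocity and boundary conditions). A path is a sequence of distinct vertices joined by edges; a path with feasible vertex variables corresponds to the trajectory obtained by concatenating its segments. Visiting a copy of a key or door vertex means visiting that region. Augmented graph $\hat{\mathcal G}$. For a set $S$ of keys let $\mathbf D(S)=\{D_i:K_i\in S\}$. Let $\mathcal E_\emptyset$ be $\mathcal E$ with all edges incident to door vertices removed, and $\mathcal E_S=\mathcal E_\emptyset\cup\{(u,v)\in\mathcal E: u\in\mathbf D(S)\text{ or }v\in\mathbf D(S)\}$. $\mathcal G_S$ is a copy of $\mathcal G$ with edge set $\mathcal E_S$. Layer $0$ is $\mathcal G_\emptyset$, where paths start. Layer $\ell$ consists of $\mathcal G_S$ for each reachable $\ell$-element $S$, where $S$ is reachable if $S=S'\cup\{K_v\}$ with $S'$ reachable, $|S'|=\ell-1$, $K_v\notin S'$, and $K_v$ reachable from the start node copy in $\mathcal G_{S'}$. For each such $S$ and $K_v\in S$ with $\mathcal G_{S\setminus\{K_v\}}$ present, a zero-cost directed edge goes from the copy of $K_v$ in $\mathcal G_{S\setminus\{K_v\}}$ to its copy in $\mathcal G_S$. All copies of the target node are merged into a single node $t$.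
   Formalization: Added: distinct doors neither overlap nor share a facet, and key K_i avoids the interior of D_j for j≠i; "in D_i" means in its interior, since free cells contain door facets. Workspace, obstacles and doors are full-dimensional; admissible velocities are bounded. *)

theory Defs
  imports "HOL-Analysis.Analysis" "HOL-Library.Disjoint_Sets"
begin

datatype 'p formula =
    Atom 'p
  | Neg "'p formula"
  | Conj "'p formula list"
  | Release "'p formula" "'p formula"
  | Eventually "'p formula"

text \<open>\<open>I p t\<close> says that proposition \<open>p\<close> is true at time \<open>t\<close>; \<open>holds I T t f\<close> says that
  \<open>f\<close> is true at time \<open>t\<close> of a signal that ends at time \<open>T\<close>. In a release, the second
  argument must hold up to and including an instant at which the first one is true, or
  else up to the end.\<close>

fun holds :: "('p \<Rightarrow> real \<Rightarrow> bool) \<Rightarrow> real \<Rightarrow> real \<Rightarrow> 'p formula \<Rightarrow> bool" where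
  "holds I T t (Atom p) \<longleftrightarrow> I p t"
| "holds I T t (Neg f) \<longleftrightarrow> \<not> holds I T t f"
| "holds I T t (Conj fs) \<longleftrightarrow> (\<forall>f\<in>set fs. holds I T t f)"
| "holds I T t (Release f g) \<longleftrightarrow>
     (\<exists>u\<in>{t..T}. holds I T u f \<and> (\<forall>s\<in>{t..u}. holds I T s g)) \<or>
     (\<forall>s\<in>{t..T}. holds I T s g)"
| "holds I T t (Eventually f) \<longleftrightarrow> (\<exists>u\<in>{t..T}. holds I T u f)"

datatype atomic_prop = InKey nat | InDoor nat | InTarget

definition key_door_spec :: "nat \<Rightarrow> atomic_prop formula" where
  "key_door_spec n =
     Conj (map (\<lambda>i. Release (Atom (InKey i)) (Neg (Atom (InDoor i)))) [1..<Suc n]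
           @ [Eventually (Atom InTarget)])"

text \<open>Keys and doors are indexed by \<open>{1..num_keys}\<close>, obstacles by \<open>{1..num_obstacles}\<close>;
  \<open>velocities\<close> is the set of admissible velocities and \<open>degree\<close> the degree of the Bezier
  segments.\<close>

record 'a environment =
  workspace :: "'a set"
  num_obstacles :: nat
  obstacle :: "nat \<Rightarrow> 'a set"
  num_keys :: nat
  key :: "nat \<Rightarrow> 'a set"
  door :: "nat \<Rightarrow> 'a set"
  start_point :: 'a
  target_point :: 'a
  target_set :: "'a set"
  velocities :: "'a set"
  degree :: nat

text \<open>The last two geometric conditions are implicit in the setting. Two adjacent doors
  would be joined by an edge that becomes available as soon as one of them is unlocked and
  so would give access to the other, and a segment in a key region that overlaps a door
  could run through that door.\<close>

definition key_door_environment :: "('a::euclidean_space, 'z) environment_scheme \<Rightarrow> bool" where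
  "key_door_environment W \<longleftrightarrow>
     polytope (workspace W) \<and> interior (workspace W) \<noteq> {} \<and>
     (\<forall>j\<in>{1..num_obstacles W}. polytope (obstacle W j) \<and> interior (obstacle W j) \<noteq> {} \<and>
        obstacle W j \<subseteq> workspace W) \<and>
     (\<forall>i\<in>{1..num_keys W}. polytope (key W i) \<and> key W i \<subseteq> workspace W) \<and>
     (\<forall>i\<in>{1..num_keys W}. polytope (door W i) \<and> interior (door W i) \<noteq> {} \<and>
        door W i \<subseteq> workspace W) \<and>
     target_point W \<in> target_set W \<and>
     convex (velocities W) \<and> bounded (velocities W) \<and>
     (\<forall>i\<in>{1..num_keys W}. \<forall>j\<in>{1..num_keys W}. i \<noteq> j \<longrightarrow>
        aff_dim (door W i \<inter> door W j) < int DIM('a) - 1) \<and>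
     (\<forall>i\<in>{1..num_keys W}. \<forall>j\<in>{1..num_keys W}. i \<noteq> j \<longrightarrow>
        key W i \<inter> interior (door W j) = {})"

text \<open>Being in a door means being in its interior: the facets of a door also belong to the
  adjacent closed free-space cells, which may be traversed without the key.\<close>

fun atom_true ::
  "('a::euclidean_space, 'z) environment_scheme \<Rightarrow> (real \<Rightarrow> 'a) \<Rightarrow> atomic_prop \<Rightarrow> real \<Rightarrow> bool" where
  "atom_true W q (InKey i) t \<longleftrightarrow> q t \<in> key W i"
| "atom_true W q (InDoor i) t \<longleftrightarrow> q t \<in> interior (door W i)"
| "atom_true W q InTarget t \<longleftrightarrow> q t \<in> target_set W"

definition satisfies_spec ::
  "('a::euclidean_space, 'z) environment_scheme \<Rightarrow> real \<Rightarrow> (real \<Rightarrow> 'a) \<Rightarrow> bool" where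
  "satisfies_spec W T q \<longleftrightarrow> holds (atom_true W q) T 0 (key_door_spec (num_keys W))"

definition trajectory ::
  "('a::euclidean_space, 'z) environment_scheme \<Rightarrow> real \<Rightarrow> (real \<Rightarrow> 'a) \<Rightarrow> bool" where
  "trajectory W T q \<longleftrightarrow>
     0 \<le> T \<and> continuous_on {0..T} q \<and> q 0 = start_point W \<and> q T = target_point W"

text \<open>For a full-dimensional polytope the affine hulls of the facets are its bounding
  hyperplanes.\<close>

definition bounding_hyperplanes :: "'a::euclidean_space set \<Rightarrow> 'a set set" where
  "bounding_hyperplanes P = {affine hull F | F. F facet_of P}"

definition cutting_hyperplanes ::
  "('a::euclidean_space, 'z) environment_scheme \<Rightarrow> 'a set set" where
  "cutting_hyperplanes W =
     bounding_hyperplanes (workspace W) \<union>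
     (\<Union>j\<in>{1..num_obstacles W}. bounding_hyperplanes (obstacle W j)) \<union>
     (\<Union>i\<in>{1..num_keys W}. bounding_hyperplanes (door W i))"

definition cells :: "('a::euclidean_space, 'z) environment_scheme \<Rightarrow> 'a set set" where
  "cells W = closure ` components (workspace W - \<Union>(cutting_hyperplanes W))"

definition kept_cells :: "('a::euclidean_space, 'z) environment_scheme \<Rightarrow> 'a set set" where
  "kept_cells W = {C \<in> cells W. \<forall>j\<in>{1..num_obstacles W}. \<not> C \<subseteq> obstacle W j}"

definition door_cells :: "('a::euclidean_space, 'z) environment_scheme \<Rightarrow> nat \<Rightarrow> 'a set set" where
  "door_cells W i = {C \<in> kept_cells W. C \<subseteq> door W i}"

definition free_cells :: "('a::euclidean_space, 'z) environment_scheme \<Rightarrow> 'a set set" where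
  "free_cells W = kept_cells W - (\<Union>i\<in>{1..num_keys W}. door_cells W i)"

text \<open>A free-space vertex is the set of the cells that are merged into it.\<close>

datatype 'a vertex = Start | Free "'a set set" | Key nat | Door nat

text \<open>\<open>start_block\<close> is the free-space vertex to which the start node is connected and
  \<open>target_block\<close> the target node.\<close>

record 'a labeled_graph = "'a environment" +
  free_vertices :: "'a set set set"
  start_block :: "'a set set"
  target_block :: "'a set set"

definition key_door_graph :: "'a::euclidean_space labeled_graph \<Rightarrow> bool" where
  "key_door_graph G \<longleftrightarrow>
     key_door_environment G \<and>
     partition_on (free_cells G) (free_vertices G) \<and>
     (\<forall>B\<in>free_vertices G. convex (\<Union>B)) \<and>
     (\<forall>i\<in>{1..num_keys G}. convex (\<Union>(door_cells G i))) \<and>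
     start_block G \<in> free_vertices G \<and> start_point G \<in> \<Union>(start_block G) \<and>
     target_block G \<in> free_vertices G \<and> target_point G \<in> \<Union>(target_block G)"

definition vertices :: "'a::euclidean_space labeled_graph \<Rightarrow> 'a vertex set" where
  "vertices G =
     {Start} \<union> Free ` free_vertices G \<union> Key ` {1..num_keys G} \<union> Door ` {1..num_keys G}"

fun cells_of :: "'a::euclidean_space labeled_graph \<Rightarrow> 'a vertex \<Rightarrow> 'a set set" where
  "cells_of G (Free B) = B"
| "cells_of G (Door i) = door_cells G i"
| "cells_of G (Key i) = {}"
| "cells_of G Start = {}"

fun region :: "'a::euclidean_space labeled_graph \<Rightarrow> 'a vertex \<Rightarrow> 'a set" where
  "region G Start = {start_point G}"
| "region G (Free B) = \<Union>B"
| "region G (Key i) = key G i"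
| "region G (Door i) = \<Union>(door_cells G i)"

definition shares_facet ::
  "'a::euclidean_space labeled_graph \<Rightarrow> 'a vertex \<Rightarrow> 'a vertex \<Rightarrow> bool" where
  "shares_facet G u v \<longleftrightarrow>
     u \<noteq> v \<and> (\<exists>C\<in>cells_of G u. \<exists>C'\<in>cells_of G v. \<exists>F. F facet_of C \<and> F facet_of C')"

definition edges :: "'a::euclidean_space labeled_graph \<Rightarrow> ('a vertex \<times> 'a vertex) set" where
  "edges G =
     (let E = {(u, v). u \<in> vertices G \<and> v \<in> vertices G \<and> shares_facet G u v}
            \<union> {(Key i, Free B) | i B.
                 i \<in> {1..num_keys G} \<and> B \<in> free_vertices G \<and> key G i \<inter> \<Union>B \<noteq> {}}
            \<union> {(Start, Free (start_block G))}
      in E \<union> E\<inverse>)"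

text \<open>Sets of keys are represented by the sets of their indices.\<close>

definition unlocked_doors :: "nat set \<Rightarrow> 'a vertex set" where
  "unlocked_doors S = Door ` S"

definition base_edges :: "'a::euclidean_space labeled_graph \<Rightarrow> ('a vertex \<times> 'a vertex) set" where
  "base_edges G = {(u, v) \<in> edges G. u \<notin> range Door \<and> v \<notin> range Door}"

definition layer_edges ::
  "'a::euclidean_space labeled_graph \<Rightarrow> nat set \<Rightarrow> ('a vertex \<times> 'a vertex) set" where
  "layer_edges G S =
     base_edges G \<union> {(u, v) \<in> edges G. u \<in> unlocked_doors S \<or> v \<in> unlocked_doors S}"

inductive reachable_keys :: "'a::euclidean_space labeled_graph \<Rightarrow> nat set \<Rightarrow> bool"
  for G where
  empty: "reachable_keys G {}"
| step: "reachable_keys G S \<Longrightarrow> i \<in> {1..num_keys G} \<Longrightarrow> i \<notin> S \<Longrightarrow>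
    (Start, Key i) \<in> (layer_edges G S)\<^sup>* \<Longrightarrow> reachable_keys G (insert i S)"

text \<open>\<open>Goal\<close> is the merged target node.\<close>

datatype 'a node = Copy "nat set" "'a vertex" | Goal

definition node :: "'a::euclidean_space labeled_graph \<Rightarrow> nat set \<Rightarrow> 'a vertex \<Rightarrow> 'a node" where
  "node G S v = (if v = Free (target_block G) then Goal else Copy S v)"

definition aug_nodes :: "'a::euclidean_space labeled_graph \<Rightarrow> 'a node set" where
  "aug_nodes G = {node G S v | S v. reachable_keys G S \<and> v \<in> vertices G}"

definition aug_edges :: "'a::euclidean_space labeled_graph \<Rightarrow> ('a node \<times> 'a node) set" where
  "aug_edges G =
     {(node G S u, node G S v) | S u v. reachable_keys G S \<and> (u, v) \<in> layer_edges G S} \<union>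
     {(Copy (S - {i}) (Key i), Copy S (Key i)) | S i.
        reachable_keys G S \<and> i \<in> S \<and> reachable_keys G (S - {i})}"

definition aug_path :: "'a::euclidean_space labeled_graph \<Rightarrow> 'a node list \<Rightarrow> bool" where
  "aug_path G p \<longleftrightarrow>
     p \<noteq> [] \<and> distinct p \<and> set p \<subseteq> aug_nodes G \<and>
     successively (\<lambda>u v. (u, v) \<in> aug_edges G) p \<and>
     hd p = Copy {} Start \<and> last p = Goal"

fun node_region :: "'a::euclidean_space labeled_graph \<Rightarrow> 'a node \<Rightarrow> 'a set" where
  "node_region G (Copy S v) = region G v"
| "node_region G Goal = \<Union>(target_block G)"

definition bezier :: "nat \<Rightarrow> (nat \<Rightarrow> 'a::real_vector) \<Rightarrow> real \<Rightarrow> 'a" where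
  "bezier N c u = (\<Sum>k\<le>N. Bernstein N k u *\<^sub>R c k)"

text \<open>A segment consists of the control points of a Bezier path \<open>r\<close> and of those of a Bezier
  time scaling \<open>h\<close>; it describes the motion that is at \<open>r u\<close> at time \<open>h u\<close> for
  \<open>0 \<le> u \<le> 1\<close>.\<close>

record 'a segment =
  points :: "nat \<Rightarrow> 'a"
  times :: "nat \<Rightarrow> real"

text \<open>The velocity condition is the convex constraint on control points that is sufficient
  for \<open>r' / h'\<close> to lie in the set of admissible velocities. As this set is bounded, the
  condition forces a segment of duration zero to be constant.\<close>

definition feasible_segment ::
  "'a::euclidean_space labeled_graph \<Rightarrow> 'a set \<Rightarrow> 'a segment \<Rightarrow> bool" where
  "feasible_segment G R x \<longleftrightarrow>
     (\<forall>k\<le>degree G. points x k \<in> R) \<and>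
     (\<forall>k<degree G. times x k \<le> times x (Suc k) \<and>
        (\<exists>w\<in>velocities G.
           points x (Suc k) - points x k = (times x (Suc k) - times x k) *\<^sub>R w))"

definition continuous_join ::
  "'a::euclidean_space labeled_graph \<Rightarrow> 'a segment \<Rightarrow> 'a segment \<Rightarrow> bool" where
  "continuous_join G x y \<longleftrightarrow>
     bezier (degree G) (points x) 1 = bezier (degree G) (points y) 0 \<and>
     bezier (degree G) (times x) 1 = bezier (degree G) (times y) 0"

text \<open>Further constraints, such as continuity of derivatives, would only shrink the set of
  feasible vertex variables.\<close>

definition feasible ::
  "'a::euclidean_space labeled_graph \<Rightarrow> 'a node list \<Rightarrow> ('a node \<Rightarrow> 'a segment) \<Rightarrow> bool" where
  "feasible G p x \<longleftrightarrow>
     (\<forall>v\<in>set p. feasible_segment G (node_region G v) (x v)) \<and>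
     successively (\<lambda>u v. continuous_join G (x u) (x v)) p \<and>
     bezier (degree G) (times (x (hd p))) 0 = 0 \<and>
     bezier (degree G) (points (x (hd p))) 0 = start_point G \<and>
     bezier (degree G) (points (x (last p))) 1 = target_point G"

text \<open>The condition determines \<open>q\<close> on the interval from 0 to \<open>T\<close>, since the time
  scalings of the segments together cover this interval.\<close>

definition concatenation ::
  "'a::euclidean_space labeled_graph \<Rightarrow> 'a node list \<Rightarrow> ('a node \<Rightarrow> 'a segment) \<Rightarrow>
     real \<Rightarrow> (real \<Rightarrow> 'a) \<Rightarrow> bool" where
  "concatenation G p x T q \<longleftrightarrow>
     T = bezier (degree G) (times (x (last p))) 1 \<and>
     (\<forall>v\<in>set p. \<forall>u\<in>{0..1}.
        q (bezier (degree G) (times (x v)) u) = bezier (degree G) (points (x v)) u)"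

end

theory Submission
  imports Defs
begin

text \<open>A component of the workspace minus all cutting hyperplanes is connected and misses the
  frontier of every door, so its closure lies in the door or misses the interior of the door.
  Hence the interior of door \<open>i\<close> is met only by the regions of the vertices \<open>Door i\<close> and
  \<open>Key i\<close>. The first of these on a path is a copy of \<open>Key i\<close>, because a layer in which
  \<open>Door i\<close> can be entered is reached only through a copy of \<open>Key i\<close>, and two doors never share a
  facet. At the moment at which the segment of \<open>Key i\<close> starts, the trajectory is still in the
  region of the previous vertex and thus outside the interior of the door. The concatenation
  is a well-defined continuous function of time since, by the bound on the velocities, each Bezier
  path is Lipschitz with respect to its time scaling.\<close>

section \<open>Bezier segments\<close>

lemma bezier_Suc:
  "bezier (Suc N) c u = (1 - u) *\<^sub>R bezier N c u + u *\<^sub>R bezier N (\<lambda>k. c (Suc k)) u"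
proof -
  have rec: "Bernstein (Suc N) (Suc k) u = u * Bernstein N k u + (1 - u) * Bernstein N (Suc k) u"
    for k
  proof (cases "k < N")
    case True
    then have "N - k = Suc (N - Suc k)" by simp
    then show ?thesis
      by (simp add: Bernstein_def algebra_simps)
  next
    case False
    then show ?thesis
      by (cases "k = N") (simp_all add: Bernstein_def binomial_eq_0)
  qed
  have zero: "Bernstein (Suc N) 0 u = (1 - u) * Bernstein N 0 u"
    by (simp add: Bernstein_def)
  have top: "Bernstein N (Suc N) u = 0"
    by (simp add: Bernstein_def)
  have "bezier (Suc N) c u =
      (1 - u) *\<^sub>R (Bernstein N 0 u *\<^sub>R c 0 + (\<Sum>k\<le>N. Bernstein N (Suc k) u *\<^sub>R c (Suc k))) +
      u *\<^sub>R (\<Sum>k\<le>N. Bernstein N k u *\<^sub>R c (Suc k))"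
    unfolding bezier_def sum.atMost_Suc_shift zero rec
    by (simp add: scaleR_add_left scaleR_add_right scaleR_sum_right sum.distrib)
  also have "Bernstein N 0 u *\<^sub>R c 0 + (\<Sum>k\<le>N. Bernstein N (Suc k) u *\<^sub>R c (Suc k)) =
      (\<Sum>k\<le>Suc N. Bernstein N k u *\<^sub>R c k)"
    by (simp only: sum.atMost_Suc_shift)
  also have "\<dots> = bezier N c u"
    by (simp add: bezier_def top)
  finally show ?thesis
    by (simp add: bezier_def)
qed

lemma bezier_in_convex:
  assumes "convex S" "\<And>k. k \<le> N \<Longrightarrow> c k \<in> S" "0 \<le> u" "u \<le> 1"
  shows "bezier N c u \<in> S"
  unfolding bezier_def
  by (rule convex_sum) (use assms in \<open>auto simp: Bernstein_nonneg\<close>)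

lemma continuous_on_bezier:
  fixes c :: "nat \<Rightarrow> 'a::real_normed_vector"
  shows "continuous_on A (bezier N c)"
  unfolding bezier_def Bernstein_def by (intro continuous_intros)

lemma norm_bezier_diff_le:
  fixes c :: "nat \<Rightarrow> 'a::real_normed_vector"
  assumes "\<And>k. k < N \<Longrightarrow> norm (c (Suc k) - c k) \<le> M * (t (Suc k) - t k)"
    and "0 \<le> u" "u \<le> u'" "u' \<le> 1"
  shows "norm (bezier N c u' - bezier N c u) \<le> M * (bezier N t u' - bezier N t u)"
  using assms(1)
proof (induction N arbitrary: c t)
  case 0
  then show ?case by (simp add: bezier_def Bernstein_def)
next
  case (Suc N)
  let ?c' = "\<lambda>k. c (Suc k)" and ?t' = "\<lambda>k. t (Suc k)"
  have 1: "norm (bezier N c u' - bezier N c u) \<le> M * (bezier N t u' - bezier N t u)"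
    using Suc by simp
  have 2: "norm (bezier N ?c' u' - bezier N ?c' u) \<le> M * (bezier N ?t' u' - bezier N ?t' u)"
    using Suc.IH[of ?c' ?t'] Suc.prems by simp
  have 3: "norm (bezier N ?c' u - bezier N c u) \<le> M * (bezier N ?t' u - bezier N t u)"
  proof -
    have "norm (bezier N ?c' u - bezier N c u) =
        norm (\<Sum>k\<le>N. Bernstein N k u *\<^sub>R (c (Suc k) - c k))"
      by (simp add: bezier_def scaleR_diff_right sum_subtractf)
    also have "\<dots> \<le> (\<Sum>k\<le>N. Bernstein N k u * (M * (t (Suc k) - t k)))"
      using assms Suc.prems
      by (intro sum_norm_le) (auto simp: Bernstein_nonneg intro!: mult_left_mono)
    also have "\<dots> = M * (bezier N ?t' u - bezier N t u)"
      by (simp add: bezier_def sum_distrib_left sum_subtractf[symmetric] algebra_simps)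
    finally show ?thesis .
  qed
  have "bezier (Suc N) c u' - bezier (Suc N) c u =
      (1 - u') *\<^sub>R (bezier N c u' - bezier N c u) + u' *\<^sub>R (bezier N ?c' u' - bezier N ?c' u) +
      (u' - u) *\<^sub>R (bezier N ?c' u - bezier N c u)"
    by (simp add: bezier_Suc algebra_simps)
  also have "norm \<dots> \<le> (1 - u') * norm (bezier N c u' - bezier N c u) +
      u' * norm (bezier N ?c' u' - bezier N ?c' u) + (u' - u) * norm (bezier N ?c' u - bezier N c u)"
    using assms by (intro norm_triangle_le add_mono) auto
  also have "\<dots> \<le> (1 - u') * (M * (bezier N t u' - bezier N t u)) +
      u' * (M * (bezier N ?t' u' - bezier N ?t' u)) + (u' - u) * (M * (bezier N ?t' u - bezier N t u))"
    using assms 1 2 3 by (intro add_mono mult_left_mono) auto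
  also have "\<dots> = M * (bezier (Suc N) t u' - bezier (Suc N) t u)"
    by (simp add: bezier_Suc algebra_simps)
  finally show ?case .
qed

section \<open>Concatenation of segments\<close>

lemma chain_cover:
  fixes h :: "nat \<Rightarrow> real \<Rightarrow> real"
  assumes "\<And>j. j \<le> m \<Longrightarrow> continuous_on {0..1} (h j)"
    and "\<And>j. j < m \<Longrightarrow> h j 1 = h (Suc j) 0"
    and "t \<in> {h 0 0..h m 1}"
  shows "\<exists>j\<le>m. \<exists>u\<in>{0..1}. h j u = t"
  using assms
proof (induction m)
  case 0
  then show ?case using IVT'[of "h 0" 0 t 1] by auto
next
  case (Suc m)
  show ?case
  proof (cases "t \<le> h m 1")
    case True
    with Suc show ?thesis by (metis atLeastAtMost_iff le_SucI less_SucI)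
  next
    case False
    then show ?thesis
      using IVT'[of "h (Suc m)" 0 t 1] Suc.prems by fastforce
  qed
qed

lemma chain_lipschitz:
  fixes r :: "nat \<Rightarrow> real \<Rightarrow> 'a::real_normed_vector"
  assumes seg: "\<And>j u u'. \<lbrakk>j < n; 0 \<le> u; u \<le> u'; u' \<le> 1\<rbrakk>
      \<Longrightarrow> norm (r j u' - r j u) \<le> M * (h j u' - h j u)"
    and join: "\<And>j. Suc j < n \<Longrightarrow> r j 1 = r (Suc j) 0 \<and> h j 1 = h (Suc j) 0"
    and "i \<le> j" "j < n" "u \<in> {0..1}" "u' \<in> {0..1}" "i = j \<Longrightarrow> u \<le> u'"
  shows "norm (r j u' - r i u) \<le> M * (h j u' - h i u)"
  using assms(3-7)
proof (induction j arbitrary: u' rule: dec_induct)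
  case base
  then show ?case using seg by auto
next
  case (step j)
  have 1: "norm (r j 1 - r i u) \<le> M * (h j 1 - h i u)"
    using step by auto
  have 2: "norm (r (Suc j) u' - r (Suc j) 0) \<le> M * (h (Suc j) u' - h (Suc j) 0)"
    using seg step by auto
  have "norm (r (Suc j) u' - r i u) \<le> norm (r (Suc j) u' - r j 1) + norm (r j 1 - r i u)"
    using norm_triangle_ineq[of "r (Suc j) u' - r j 1" "r j 1 - r i u"] by simp
  then show ?case
    using 1 2 join[of j] step by (simp add: algebra_simps)
qed

lemma chain_glue:
  fixes r :: "nat \<Rightarrow> real \<Rightarrow> 'a::real_normed_vector"
  assumes "0 < M" and "0 < n"
    and seg: "\<And>j u u'. \<lbrakk>j < n; 0 \<le> u; u \<le> u'; u' \<le> 1\<rbrakk>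
      \<Longrightarrow> norm (r j u' - r j u) \<le> M * (h j u' - h j u)"
    and join: "\<And>j. Suc j < n \<Longrightarrow> r j 1 = r (Suc j) 0 \<and> h j 1 = h (Suc j) 0"
    and cont: "\<And>j. j < n \<Longrightarrow> continuous_on {0..1} (h j)"
  shows "\<exists>q. (\<forall>j<n. \<forall>u\<in>{0..1}. q (h j u) = r j u) \<and> continuous_on {h 0 0..h (n - 1) 1} q"
proof -
  have lip: "norm (r j u' - r i u) \<le> M * \<bar>h j u' - h i u\<bar>"
    if *: "i < n" "j < n" "u \<in> {0..1}" "u' \<in> {0..1}" for i j u u'
  proof (cases "i < j \<or> i = j \<and> u \<le> u'")
    case True
    then have "norm (r j u' - r i u) \<le> M * (h j u' - h i u)"
      using * by (intro chain_lipschitz[where n = n and r = r and h = h and M = M, OF seg join]) auto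
    also have "\<dots> \<le> M * \<bar>h j u' - h i u\<bar>"
      using \<open>0 < M\<close> by (intro mult_left_mono) auto
    finally show ?thesis .
  next
    case False
    then have "norm (r i u - r j u') \<le> M * (h i u - h j u')"
      using * by (intro chain_lipschitz[where n = n and r = r and h = h and M = M, OF seg join]) auto
    also have "\<dots> \<le> M * \<bar>h j u' - h i u\<bar>"
      using \<open>0 < M\<close> by (intro mult_left_mono) auto
    finally show ?thesis by (simp add: norm_minus_commute)
  qed
  define q where "q t = (SOME y. \<exists>j<n. \<exists>u\<in>{0..1}. h j u = t \<and> r j u = y)" for t
  have q: "q (h j u) = r j u" if "j < n" "u \<in> {0..1}" for j u
  proof -
    have "\<exists>i<n. \<exists>v\<in>{0..1}. h i v = h j u \<and> r i v = q (h j u)"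
      unfolding q_def by (rule someI_ex) (use that in blast)
    then obtain i v where "i < n" "v \<in> {0..1}" "h i v = h j u" "r i v = q (h j u)" by blast
    then show ?thesis using lip[of i j v u] that by simp
  qed
  have cover: "\<exists>j<n. \<exists>u\<in>{0..1}. h j u = t" if "t \<in> {h 0 0..h (n - 1) 1}" for t
  proof -
    have "\<exists>j\<le>n - 1. \<exists>u\<in>{0..1}. h j u = t"
      using that cont join \<open>0 < n\<close> by (intro chain_cover) auto
    then show ?thesis using \<open>0 < n\<close> by (metis Suc_pred' less_Suc_eq_le)
  qed
  have "M-lipschitz_on {h 0 0..h (n - 1) 1} q"
  proof (rule lipschitz_onI)
    fix s t assume "s \<in> {h 0 0..h (n - 1) 1}" "t \<in> {h 0 0..h (n - 1) 1}"
    then obtain i j u v where "i < n" "j < n" "u \<in> {0..1}" "v \<in> {0..1}" "s = h i u" "t = h j v"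
      using cover by metis
    then show "dist (q s) (q t) \<le> M * dist s t"
      using lip[of j i v u] by (simp add: q dist_norm)
  qed (use \<open>0 < M\<close> in simp)
  then show ?thesis
    using q lipschitz_on_continuous_on by blast
qed

lemma holds_release_atom:
  "holds I T 0 (Release (Atom a) (Neg (Atom b))) \<longleftrightarrow>
    (\<exists>u\<in>{0..T}. I a u \<and> (\<forall>s\<in>{0..u}. \<not> I b s)) \<or> (\<forall>s\<in>{0..T}. \<not> I b s)"
  by simp

section \<open>Cells\<close>

lemma frontier_subset_bounding_hyperplanes:
  assumes "polytope P" "interior P \<noteq> {}"
  shows "frontier P \<subseteq> \<Union>(bounding_hyperplanes P)"
proof -
  have "affine hull P = UNIV"
    using assms(2) affine_hull_nonempty_interior by blast
  then have "frontier P = rel_frontier P"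
    using assms rel_frontier_nonempty_interior by blast
  also have "\<dots> = \<Union>{F. F facet_of P}"
    using assms(1) rel_frontier_of_polyhedron polytope_imp_polyhedron by blast
  finally show ?thesis
    unfolding bounding_hyperplanes_def using hull_subset by fastforce
qed

lemma finite_bounding_hyperplanes:
  assumes "polytope P"
  shows "finite (bounding_hyperplanes P)"
proof -
  have "finite {F. F facet_of P}"
    using assms finite_polytope_facets by blast
  then show ?thesis by (simp add: bounding_hyperplanes_def setcompr_eq_image)
qed

lemma closed_bounding_hyperplane: "H \<in> bounding_hyperplanes P \<Longrightarrow> closed H"
  by (auto simp: bounding_hyperplanes_def)

context
  fixes W :: "('a::euclidean_space, 'z) environment_scheme"
  assumes env: "key_door_environment W"
begin

lemma open_cut_workspace: "open (workspace W - \<Union>(cutting_hyperplanes W))"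
proof -
  have "finite (cutting_hyperplanes W)"
    using env unfolding cutting_hyperplanes_def key_door_environment_def
    by (auto intro!: finite_bounding_hyperplanes)
  moreover have "closed H" if "H \<in> cutting_hyperplanes W" for H
    using that closed_bounding_hyperplane unfolding cutting_hyperplanes_def by blast
  ultimately have "closed (\<Union>(cutting_hyperplanes W))" by blast
  moreover have "frontier (workspace W) \<subseteq> \<Union>(cutting_hyperplanes W)"
    using env frontier_subset_bounding_hyperplanes[of "workspace W"]
    unfolding cutting_hyperplanes_def key_door_environment_def by blast
  then have "workspace W - \<Union>(cutting_hyperplanes W) =
      interior (workspace W) - \<Union>(cutting_hyperplanes W)"
    using closure_subset interior_subset unfolding frontier_def by blast
  ultimately show ?thesis by (simp add: open_Diff)
qed

lemma cell_full_dim: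
  assumes "C \<in> cells W"
  shows "aff_dim C = int DIM('a)"
proof -
  obtain K where K: "K \<in> components (workspace W - \<Union>(cutting_hyperplanes W))" "C = closure K"
    using assms by (auto simp: cells_def)
  then have "open K" "K \<noteq> {}"
    using open_components open_cut_workspace in_components_nonempty by blast+
  then show ?thesis
    using K by (simp add: aff_dim_open)
qed

lemma cell_in_or_misses_door:
  assumes "C \<in> cells W" "i \<in> {1..num_keys W}"
  shows "C \<subseteq> door W i \<or> C \<inter> interior (door W i) = {}"
proof -
  obtain K where K: "K \<in> components (workspace W - \<Union>(cutting_hyperplanes W))" "C = closure K"
    using assms by (auto simp: cells_def)
  have door: "polytope (door W i)" "interior (door W i) \<noteq> {}"
    using env assms unfolding key_door_environment_def by auto
  have "frontier (door W i) \<subseteq> \<Union>(cutting_hyperplanes W)"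
    using frontier_subset_bounding_hyperplanes[OF door] assms(2)
    unfolding cutting_hyperplanes_def by blast
  then have "K \<inter> frontier (door W i) = {}"
    using in_components_subset[OF K(1)] by blast
  then have "K \<subseteq> door W i \<or> K \<inter> door W i = {}"
    using connected_Int_frontier[of K "door W i"] in_components_connected[OF K(1)] by blast
  then show ?thesis
  proof
    assume "K \<subseteq> door W i"
    then show ?thesis
      using K(2) door(1) closure_minimal polytope_imp_closed by blast
  next
    assume "K \<inter> door W i = {}"
    then have "closure K \<inter> interior (door W i) = {}"
      using open_Int_closure_eq_empty[of "interior (door W i)" K] interior_subset by blast
    then show ?thesis using K(2) by blast
  qed
qed

lemma free_cell_misses_door:
  assumes "C \<in> free_cells W" "i \<in> {1..num_keys W}"
  shows "C \<inter> interior (door W i) = {}"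
  using cell_in_or_misses_door assms
  unfolding free_cells_def door_cells_def kept_cells_def by blast

lemma no_common_large_subset:
  assumes "i \<in> {1..num_keys W}" "j \<in> {1..num_keys W}" "i \<noteq> j"
    and "F \<subseteq> door W i" "F \<subseteq> door W j"
  shows "aff_dim F < int DIM('a) - 1"
proof -
  have "aff_dim F \<le> aff_dim (door W i \<inter> door W j)"
    using assms by (intro aff_dim_subset) auto
  also have "\<dots> < int DIM('a) - 1"
    using env assms unfolding key_door_environment_def by auto
  finally show ?thesis .
qed

lemma door_cell_misses_other_door:
  assumes "C \<in> door_cells W j" "i \<in> {1..num_keys W}" "j \<in> {1..num_keys W}" "i \<noteq> j"
  shows "C \<inter> interior (door W i) = {}"
proof -
  have C: "C \<in> cells W" "C \<subseteq> door W j"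
    using assms unfolding door_cells_def kept_cells_def by auto
  have "\<not> C \<subseteq> door W i"
    using no_common_large_subset[of i j C] cell_full_dim[OF C(1)] C assms by auto
  then show ?thesis using cell_in_or_misses_door C assms by blast
qed

lemma door_cells_share_no_facet:
  assumes "C \<in> door_cells W i" "C' \<in> door_cells W j"
    and "i \<in> {1..num_keys W}" "j \<in> {1..num_keys W}" "i \<noteq> j"
  shows "\<not> (F facet_of C \<and> F facet_of C')"
proof
  assume F: "F facet_of C \<and> F facet_of C'"
  have C: "C \<in> cells W" "C \<subseteq> door W i" "C' \<subseteq> door W j"
    using assms unfolding door_cells_def kept_cells_def by auto
  have "aff_dim F = int DIM('a) - 1"
    using F cell_full_dim[OF C(1)] by (simp add: facet_of_def)
  moreover have "F \<subseteq> C" "F \<subseteq> C'"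
    using F facet_of_imp_subset by auto
  ultimately show False
    using no_common_large_subset[of i j F] C assms by auto
qed

end

section \<open>Paths in the augmented graph\<close>

context
  fixes G :: "'a::euclidean_space labeled_graph"
  assumes graph: "key_door_graph G"
begin

lemma environment: "key_door_environment G"
  using graph by (simp add: key_door_graph_def)

lemma block_misses_door:
  assumes "B \<in> free_vertices G" "i \<in> {1..num_keys G}"
  shows "\<Union>B \<inter> interior (door G i) = {}"
proof -
  have "B \<subseteq> free_cells G"
    using graph assms(1) unfolding key_door_graph_def partition_on_def by blast
  then show ?thesis
    using free_cell_misses_door[OF environment _ assms(2)] by blast
qed

lemma convex_region:
  assumes "v \<in> vertices G"
  shows "convex (region G v)"
  using assms graph
  by (cases v) (auto simp: vertices_def key_door_graph_def key_door_environment_def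
      intro: polytope_imp_convex)

lemma region_misses_door:
  assumes "v \<in> vertices G" "i \<in> {1..num_keys G}" "v \<noteq> Key i" "v \<noteq> Door i"
  shows "region G v \<inter> interior (door G i) = {}"
proof (cases v)
  case Start
  have "start_block G \<in> free_vertices G" "start_point G \<in> \<Union>(start_block G)"
    using graph by (auto simp: key_door_graph_def)
  then show ?thesis
    using block_misses_door[of "start_block G" i] assms Start by auto
next
  case (Free B)
  then have "B \<in> free_vertices G" using assms(1) by (auto simp: vertices_def)
  then show ?thesis using block_misses_door assms(2) Free by simp
next
  case (Key j)
  then have "j \<in> {1..num_keys G}" "j \<noteq> i" using assms by (auto simp: vertices_def)
  then show ?thesis
    using environment assms(2) Key unfolding key_door_environment_def by auto
next
  case (Door j)
  then have "j \<in> {1..num_keys G}" "j \<noteq> i" using assms by (auto simp: vertices_def)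
  then show ?thesis
    using door_cell_misses_other_door[OF environment, of _ j i] assms(2) Door by auto
qed

lemma node_region_node: "node_region G (node G S v) = region G v"
  by (simp add: node_def)

lemma aug_nodeE:
  assumes "a \<in> aug_nodes G"
  obtains S v where "a = node G S v" "v \<in> vertices G"
  using assms by (auto simp: aug_nodes_def)

lemma convex_node_region: "a \<in> aug_nodes G \<Longrightarrow> convex (node_region G a)"
  by (metis aug_nodeE node_region_node convex_region)

lemma node_region_misses_door:
  assumes "a \<in> aug_nodes G" "i \<in> {1..num_keys G}"
    and "\<And>S. a \<noteq> Copy S (Key i)" "\<And>S. a \<noteq> Copy S (Door i)"
  shows "node_region G a \<inter> interior (door G i) = {}"
proof -
  obtain S v where a: "a = node G S v" "v \<in> vertices G"
    using assms(1) aug_nodeE by metis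
  then have "v \<noteq> Key i" "v \<noteq> Door i"
    using assms(3,4)[of S] by (auto simp: node_def)
  then show ?thesis
    using region_misses_door a assms(2) by (simp add: node_region_node)
qed

lemma edge_between_doors:
  assumes "(Door i, Door j) \<in> edges G"
  shows False
proof -
  have *: False if "Door a \<in> vertices G" "Door b \<in> vertices G" "shares_facet G (Door a) (Door b)"
    for a b
    using that door_cells_share_no_facet[OF environment, of _ a _ b]
    by (auto simp: shares_facet_def vertices_def)
  show False using assms * by (auto simp: edges_def Let_def)
qed

lemma layer_edge_into_door:
  assumes "(u, Door i) \<in> layer_edges G S"
  shows "i \<in> S"
  using assms edge_between_doors
  by (auto simp: layer_edges_def base_edges_def unlocked_doors_def)

lemma aug_edge_cases:
  assumes "(a, Copy S v) \<in> aug_edges G" "a \<noteq> Goal"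
  obtains (layer) u where "a = Copy S u" "(u, v) \<in> layer_edges G S"
  | (key) i where "a = Copy (S - {i}) (Key i)" "v = Key i" "i \<in> S"
  using assms by (auto simp: aug_edges_def node_def split: if_splits)

lemma goal_not_inner:
  assumes "aug_path G p" "Suc m < length p"
  shows "p ! m \<noteq> Goal"
proof
  assume "p ! m = Goal"
  moreover have "p ! (length p - 1) = Goal"
    using assms by (metis aug_path_def last_conv_nth)
  moreover have "distinct p" using assms(1) by (simp add: aug_path_def)
  moreover have "m < length p" "length p - 1 < length p" "m \<noteq> length p - 1"
    using assms(2) by auto
  ultimately show False
    using nth_eq_iff_index_eq[of p m "length p - 1"] by simp
qed

lemma aug_path_edge:
  assumes "aug_path G p" "Suc m < length p"
  shows "(p ! m, p ! Suc m) \<in> aug_edges G"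
  using assms by (auto simp: aug_path_def successively_conv_nth)

lemma collected_key_visited:
  assumes "aug_path G p" "m < length p" "p ! m = Copy S v" "i \<in> S"
  shows "\<exists>k<m. \<exists>S'. p ! k = Copy S' (Key i)"
  using assms(2-4)
proof (induction m arbitrary: S v)
  case 0
  then show ?case
    using assms(1) by (auto simp: aug_path_def hd_conv_nth)
next
  case (Suc m)
  have "(p ! m, Copy S v) \<in> aug_edges G"
    using aug_path_edge[OF assms(1)] Suc.prems by metis
  moreover have "p ! m \<noteq> Goal"
    using goal_not_inner[OF assms(1)] Suc.prems by simp
  ultimately show ?case
  proof (cases rule: aug_edge_cases)
    case (layer u)
    then show ?thesis using Suc less_Suc_eq Suc_lessD by metis
  next
    case (key j)
    show ?thesis
    proof (cases "i = j")
      case True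
      then show ?thesis using key by auto
    next
      case False
      then have "i \<in> S - {j}" using Suc.prems by simp
      then show ?thesis using Suc.IH[OF _ key(1)] Suc.prems(1) less_SucI Suc_lessD by metis
    qed
  qed
qed

lemma key_before_door:
  assumes "aug_path G p" "m < length p" "p ! m = Copy S (Door i)"
  shows "\<exists>k<m. \<exists>S'. p ! k = Copy S' (Key i)"
proof (cases m)
  case 0
  then show ?thesis using assms by (auto simp: aug_path_def hd_conv_nth)
next
  case (Suc l)
  have "(p ! l, Copy S (Door i)) \<in> aug_edges G" "p ! l \<noteq> Goal"
    using aug_path_edge[OF assms(1), of l] goal_not_inner[OF assms(1), of l] assms Suc by auto
  then have "i \<in> S"
    by (cases rule: aug_edge_cases) (auto dest: layer_edge_into_door)
  then show ?thesis using collected_key_visited assms by blast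
qed

lemma path_meets_key_first:
  assumes "aug_path G p" "i \<in> {1..num_keys G}"
  shows "(\<forall>j<length p. node_region G (p ! j) \<inter> interior (door G i) = {}) \<or>
    (\<exists>m<length p. 0 < m \<and> node_region G (p ! m) = key G i \<and>
      (\<forall>j<m. node_region G (p ! j) \<inter> interior (door G i) = {}))"
proof (cases "\<exists>m<length p. \<exists>S. p ! m = Copy S (Key i)")
  case True
  define m where "m = (LEAST m. m < length p \<and> (\<exists>S. p ! m = Copy S (Key i)))"
  have m: "m < length p" "\<exists>S. p ! m = Copy S (Key i)"
    unfolding m_def using LeastI_ex[OF True[unfolded Bex_def]] by auto
  have first: "p ! j \<noteq> Copy S (Key i)" if "j < m" for j S
    using not_less_Least[OF that[unfolded m_def]] that m(1) by auto
  have "p ! 0 = Copy {} Start"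
    using assms(1) by (auto simp: aug_path_def hd_conv_nth)
  then have "0 < m" using m by (cases m) auto
  moreover have "node_region G (p ! j) \<inter> interior (door G i) = {}" if "j < m" for j
  proof (rule node_region_misses_door)
    show "p ! j \<in> aug_nodes G"
      using assms(1) that m(1) by (auto simp: aug_path_def)
    show "p ! j \<noteq> Copy S (Door i)" for S
      using key_before_door[OF assms(1), of j S i] first that m(1) by (meson order.strict_trans)
  qed (use assms first that in auto)
  moreover have "node_region G (p ! m) = key G i" using m(2) by auto
  ultimately show ?thesis using m(1) by blast
next
  case False
  have "node_region G (p ! j) \<inter> interior (door G i) = {}" if "j < length p" for j
  proof (rule node_region_misses_door)
    show "p ! j \<in> aug_nodes G"
      using assms(1) that by (auto simp: aug_path_def)
    show "p ! j \<noteq> Copy S (Door i)" for S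
      using key_before_door[OF assms(1), of j S i] False that by (meson order.strict_trans)
  qed (use assms False that in auto)
  then show ?thesis by blast
qed

end

theorem lemma1:
  fixes G :: "'a::euclidean_space labeled_graph"
    and p :: "'a node list"
    and x :: "'a node \<Rightarrow> 'a segment"
  assumes "key_door_graph G"
    and "aug_path G p"
    and "feasible G p x"
  shows "\<exists>T q. concatenation G p x T q \<and> trajectory G T q \<and> satisfies_spec G T q"
proof -
  note env = environment[OF assms(1)]
  define n where "n = length p"
  define h where "h j = bezier (degree G) (times (x (p ! j)))" for j
  define r where "r j = bezier (degree G) (points (x (p ! j)))" for j
  define T where "T = h (n - 1) 1"
  have n: "0 < n" and ends: "hd p = p ! 0" "last p = p ! (n - 1)"
    using assms(2) by (auto simp: aug_path_def n_def hd_conv_nth last_conv_nth)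
  have feas: "feasible_segment G (node_region G (p ! j)) (x (p ! j))" if "j < n" for j
    using assms(3) that by (simp add: feasible_def n_def)
  have join: "r j 1 = r (Suc j) 0 \<and> h j 1 = h (Suc j) 0" if "Suc j < n" for j
    using assms(3) that
    by (auto simp: feasible_def successively_conv_nth continuous_join_def n_def h_def r_def)
  have cont: "continuous_on {0..1} (h j)" for j
    unfolding h_def by (rule continuous_on_bezier)
  have in_region: "r j u \<in> node_region G (p ! j)" if "j < n" "u \<in> {0..1}" for j u
  proof -
    have "p ! j \<in> aug_nodes G" using assms(2) that by (auto simp: aug_path_def n_def)
    then show ?thesis
      unfolding r_def using feas[OF that(1)] that(2)
      by (intro bezier_in_convex convex_node_region[OF assms(1)]) (auto simp: feasible_segment_def)
  qed
  obtain M where M: "0 < M" "\<And>w. w \<in> velocities G \<Longrightarrow> norm w \<le> M"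
    using env bounded_pos unfolding key_door_environment_def by metis
  have seg: "norm (r j u' - r j u) \<le> M * (h j u' - h j u)"
    if j: "j < n" "0 \<le> u" "u \<le> u'" "u' \<le> 1" for j u u'
    unfolding r_def h_def
  proof (rule norm_bezier_diff_le)
    fix k assume k: "k < degree G"
    let ?x = "x (p ! j)"
    obtain w where "w \<in> velocities G" "times ?x k \<le> times ?x (Suc k)"
      "points ?x (Suc k) - points ?x k = (times ?x (Suc k) - times ?x k) *\<^sub>R w"
      using feas[OF j(1)] k unfolding feasible_segment_def by metis
    then show "norm (points ?x (Suc k) - points ?x k) \<le> M * (times ?x (Suc k) - times ?x k)"
      using M(2)[of w] by (simp add: mult.commute mult_right_mono)
  qed (use j in auto)
  obtain q where q: "\<And>j u. \<lbrakk>j < n; u \<in> {0..1}\<rbrakk> \<Longrightarrow> q (h j u) = r j u"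
    and cont_q: "continuous_on {h 0 0..h (n - 1) 1} q"
    using chain_glue[where n = n and h = h and r = r and M = M, OF M(1) n seg join cont] by blast
  have h0: "h 0 0 = 0" and r0: "r 0 0 = start_point G" and r1: "r (n - 1) 1 = target_point G"
    using assms(3) ends by (auto simp: feasible_def h_def r_def)
  have h_order: "h i u \<le> h j v"
    if "i \<le> j" "j < n" "u \<in> {0..1}" "v \<in> {0..1}" "i = j \<Longrightarrow> u \<le> v" for i j u v
  proof -
    have "norm (r j v - r i u) \<le> M * (h j v - h i u)"
      using that by (intro chain_lipschitz[where n = n and r = r and h = h and M = M, OF seg join]) auto
    then have "0 \<le> M * (h j v - h i u)"
      using norm_ge_zero order_trans by blast
    then show ?thesis using M(1) by (simp add: zero_le_mult_iff)
  qed
  have outside: "q t \<notin> interior (door G i)"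
    if "m < n" "t \<in> {0..h m 1}"
      "\<And>j. j \<le> m \<Longrightarrow> node_region G (p ! j) \<inter> interior (door G i) = {}" for m t i
  proof -
    have "\<exists>j\<le>m. \<exists>u\<in>{0..1}. h j u = t"
      using that h0 join cont by (intro chain_cover) auto
    then obtain j u where "j \<le> m" "u \<in> {0..1}" "h j u = t" by blast
    then show ?thesis
      using q[of j u] in_region[of j u] that by (auto dest!: that(3))
  qed
  have "concatenation G p x T q"
    unfolding concatenation_def
  proof (intro conjI ballI)
    show "T = bezier (degree G) (times (x (last p))) 1"
      by (simp add: T_def h_def ends)
    fix v u assume "v \<in> set p" "u \<in> {0..1::real}"
    then show "q (bezier (degree G) (times (x v)) u) = bezier (degree G) (points (x v)) u"
      using q unfolding h_def r_def n_def by (metis in_set_conv_nth)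
  qed
  moreover have traj: "trajectory G T q"
    unfolding trajectory_def
    using h_order[of 0 "n - 1" 0 1] h0 r0 r1 q[of 0 0] q[of "n - 1" 1] n cont_q
    by (simp add: T_def)
  moreover have "satisfies_spec G T q"
  proof -
    have "holds (atom_true G q) T 0 (Release (Atom (InKey i)) (Neg (Atom (InDoor i))))"
      if i: "i \<in> {1..num_keys G}" for i
      using path_meets_key_first[OF assms(1,2) i]
    proof (elim disjE exE conjE)
      assume "\<forall>j<length p. node_region G (p ! j) \<inter> interior (door G i) = {}"
      then have "q s \<notin> interior (door G i)" if "s \<in> {0..T}" for s
        using outside[of "n - 1" s i] n that by (auto simp: T_def n_def)
      then show ?thesis unfolding holds_release_atom by simp
    next
      fix m assume m: "m < length p" "0 < m" "node_region G (p ! m) = key G i"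
        and before: "\<forall>j<m. node_region G (p ! j) \<inter> interior (door G i) = {}"
      have eq: "h m 0 = h (m - 1) 1"
        using join[of "m - 1"] m by (simp add: n_def)
      have "q (h m 0) \<in> key G i"
        using q[of m 0] in_region[of m 0] m by (simp add: n_def)
      moreover have "q s \<notin> interior (door G i)" if "s \<in> {0..h m 0}" for s
        using outside[of "m - 1" s i] that m before eq by (auto simp: n_def)
      moreover have "h m 0 \<in> {0..T}"
        using h_order[of 0 m 0 0] h_order[of m "n - 1" 0 1] m h0 by (auto simp: T_def n_def)
      ultimately show ?thesis unfolding holds_release_atom atom_true.simps by blast
    qed
    moreover have "holds (atom_true G q) T 0 (Eventually (Atom InTarget))"
    proof -
      have "q T \<in> target_set G" "T \<in> {0..T}"
        using traj env by (simp_all add: trajectory_def key_door_environment_def)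
      then show ?thesis by auto
    qed
    ultimately show ?thesis
      unfolding satisfies_spec_def key_door_spec_def by (auto simp del: holds.simps(4,5))
  qed
  ultimately show ?thesis by blast
qed

end
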